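(* Let $T=\sum_{\lambda\in\Lambda}c_\lambda U_\lambda$ with $\Lambda\subset\mathbb{R}^{2d}$ finite, and assume $T$ is invertible in $B(L^2(\mathbb{R}^d))$. Write $T^{-1}=\sum_{\mu\in\mathbb{R}^{2d}}d_\mu U_\mu$ (with $\sum_\mu|d_\mu|<\infty$). Then there is $\delta>0$ such that $$\sum_{\mu\in\mathbb{R}^{2d}}e^{\delta|\mu|}|d_\mu|<\infty.$$
   Context: For $\lambda=(t,\omega)\in\mathbb{R}^d\times\mathbb{R}^d$, $U_{(t,\omega)}f(x)=e^{i\langle\omega,x\rangle}f(x-t)$ on $L^2(\mathbb{R}^d)$. $|\mu|$ denotes the max-norm ($\ell^\infty$ norm) of $\mu\in\mathbb{R}^{2d}$. *)

theory Defs
  imports "HOL-Analysis.Analysis"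
begin

type_synonym 'n tf_index = "(real^'n) \<times> (real^'n)"

text \<open>Time-frequency shift: for l = (t, w), U_l f x = e^{i <w,x>} f (x - t).
  Functions on R^d are represented by real^'n \<Rightarrow> complex; elements of L^2 are
  representatives, identified up to Lebesgue-a.e. equality.\<close>

definition tf_shift :: "'n tf_index \<Rightarrow> (real^'n \<Rightarrow> complex) \<Rightarrow> real^'n \<Rightarrow> complex" where
  "tf_shift l f x = cis (snd l \<bullet> x) * f (x - fst l)"

definition L2 :: "(real^'n \<Rightarrow> complex) set" where
  "L2 = {f. f \<in> borel_measurable lebesgue \<and> integrable lebesgue (\<lambda>x. (cmod (f x))\<^sup>2)}"

definition tf_finite_op ::
  "'n tf_index set \<Rightarrow> ('n tf_index \<Rightarrow> complex) \<Rightarrow> (real^'n \<Rightarrow> complex) \<Rightarrow> real^'n \<Rightarrow> complex" where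
  "tf_finite_op \<Lambda> c f = (\<lambda>x. \<Sum>l\<in>\<Lambda>. c l * tf_shift l f x)"

text \<open>The operator sum over all mu in R^{2d} of d_mu U_mu, for absolutely summable d,
  evaluated pointwise (the pointwise series converges a.e. and agrees a.e. with the
  L^2-norm convergent series).\<close>
definition tf_series_op ::
  "('n tf_index \<Rightarrow> complex) \<Rightarrow> (real^'n \<Rightarrow> complex) \<Rightarrow> real^'n \<Rightarrow> complex" where
  "tf_series_op d f = (\<lambda>x. infsum (\<lambda>l. d l * tf_shift l f x) UNIV)"

end

theory Submission
  imports Defs
begin

text \<open>
  The coefficients of an absolutely summable series of time-frequency shifts are determined by the
  operator: conjugating with time-frequency shifts turns a vanishing series into a vanishing almost
  periodic series. Hence \<open>c * d = d * c = 1\<close> for the twisted convolution, \<open>c\<close> and \<open>d\<close> being the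
  coefficients of \<open>T\<close> and of its inverse. Restrict \<open>d\<close> to a finite set \<open>F\<close> to get \<open>d'\<close> with
  \<open>r = 1 - c * d'\<close> of \<open>\<ell>\<^sup>1\<close>-norm less than \<open>1\<close>. Then \<open>d = d' + d * r\<close>, and as \<open>d'\<close> and \<open>r\<close> are
  finitely supported, the norm of \<open>r\<close> with weight \<open>exp (\<delta> |\<mu>|)\<close> is still less than \<open>1\<close> for small
  \<open>\<delta>\<close>, which bounds the weighted norm of \<open>d\<close>.
\<close>

section \<open>Unordered sums: finite combinations, translation, small tails\<close>

lemma has_sum_sum_finite:
  fixes f :: "'i \<Rightarrow> 'a \<Rightarrow> 'b::{topological_comm_monoid_add}"
  assumes "finite S" "\<And>l. l \<in> S \<Longrightarrow> (f l has_sum s l) A"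
  shows "((\<lambda>x. \<Sum>l\<in>S. f l x) has_sum (\<Sum>l\<in>S. s l)) A"
  using assms by (induction S) (auto intro!: has_sum_add)

lemma has_sum_translate_iff:
  fixes g :: "'a::ab_group_add \<Rightarrow> 'b::{topological_comm_monoid_add}"
  shows "((\<lambda>m. g (m - l)) has_sum s) UNIV \<longleftrightarrow> (g has_sum s) UNIV"
  by (rule has_sum_reindex_bij_betw) (rule bij_betwI[where g="\<lambda>x. x + l"], auto)

lemma abs_summable_small_tail:
  fixes d :: "'a \<Rightarrow> 'b::real_normed_vector"
  assumes "(\<lambda>m. norm (d m)) summable_on UNIV" "e > 0"
  obtains F where "finite F" "(\<Sum>\<^sub>\<infinity>m\<in>-F. norm (d m)) < e"
proof -
  obtain F where F: "finite F" "dist (\<Sum>m\<in>F. norm (d m)) (\<Sum>\<^sub>\<infinity>m. norm (d m)) \<le> e/2"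
    using infsum_finite_approximation[OF assms(1), of "e/2"] assms(2) by auto
  have "(\<Sum>\<^sub>\<infinity>m\<in>UNIV-F. norm (d m)) = (\<Sum>\<^sub>\<infinity>m. norm (d m)) - (\<Sum>\<^sub>\<infinity>m\<in>F. norm (d m))"
    using F by (intro infsum_Diff assms) auto
  then have "(\<Sum>\<^sub>\<infinity>m\<in>-F. norm (d m)) < e"
    using F assms(2) unfolding dist_real_def Compl_eq_Diff_UNIV by (simp, linarith)
  with F that show thesis by blast
qed

section \<open>Uniqueness of coefficients of trigonometric series\<close>

text \<open>For each frequency \<open>\<mu> \<in> F\<close> average with a translate by some \<open>\<lambda>\<close> such that
  \<open>cis (\<mu> \<bullet> \<lambda>) = -1\<close>; this removes \<open>\<mu>\<close> and does not increase any coefficient.\<close>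

lemma trig_series_cancel_finite:
  fixes b :: "'a::real_inner \<Rightarrow> complex"
  assumes "finite F" "0 \<notin> F" "\<And>\<xi>. ((\<lambda>\<mu>. b \<mu> * cis (\<mu> \<bullet> \<xi>)) has_sum 0) UNIV"
  shows "\<exists>b'. b' 0 = b 0 \<and> (\<forall>\<mu>. norm (b' \<mu>) \<le> norm (b \<mu>)) \<and> (\<forall>\<mu>\<in>F. b' \<mu> = 0)
    \<and> (\<forall>\<xi>. ((\<lambda>\<mu>. b' \<mu> * cis (\<mu> \<bullet> \<xi>)) has_sum 0) UNIV)"
  using assms
proof (induction F)
  case empty
  then show ?case by (intro exI[of _ b]) auto
next
  case (insert \<nu> F)
  then obtain b' where b': "b' 0 = b 0" "\<And>\<mu>. norm (b' \<mu>) \<le> norm (b \<mu>)" "\<And>\<mu>. \<mu>\<in>F \<Longrightarrow> b' \<mu> = 0"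
    "\<And>\<xi>. ((\<lambda>\<mu>. b' \<mu> * cis (\<mu> \<bullet> \<xi>)) has_sum 0) UNIV" by auto
  define z where "z = (pi / (\<nu> \<bullet> \<nu>)) *\<^sub>R \<nu>"
  have z: "cis (\<nu> \<bullet> z) = -1"
    using insert.prems by (auto simp: z_def)
  \<comment> \<open>Averaging the series at \<xi> and \<xi> + \<open>z\<close> multiplies each
    coefficient by this factor, which is 1 at frequency 0 and 0 at \<nu>. Coefficients that were
    already zero stay zero.\<close>
  define b'' where "b'' = (\<lambda>\<mu>. b' \<mu> * ((1 + cis (\<mu> \<bullet> z)) / 2))"
  have le1: "norm ((1 + cis (\<mu> \<bullet> z)) / 2) \<le> 1" for \<mu>
    using norm_triangle_ineq[of 1 "cis (\<mu> \<bullet> z)"] by (simp add: norm_divide)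
  have "norm (b'' \<mu>) \<le> norm (b \<mu>)" for \<mu>
    using mult_mono[OF b'(2)[of \<mu>] le1[of \<mu>]] by (simp add: b''_def norm_mult)
  moreover have "((\<lambda>\<mu>. b'' \<mu> * cis (\<mu> \<bullet> \<xi>)) has_sum 0) UNIV" for \<xi>
  proof -
    have "((\<lambda>\<mu>. (b' \<mu> * cis (\<mu> \<bullet> \<xi>) + b' \<mu> * cis (\<mu> \<bullet> (\<xi> + z))) * (1/2)) has_sum ((0 + 0) * (1/2))) UNIV"
      by (intro has_sum_cmult_left has_sum_add b')
    moreover have "(b' \<mu> * cis (\<mu> \<bullet> \<xi>) + b' \<mu> * cis (\<mu> \<bullet> (\<xi> + z))) * (1/2) = b'' \<mu> * cis (\<mu> \<bullet> \<xi>)" for \<mu>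
      by (simp add: b''_def inner_add_right cis_mult[symmetric] algebra_simps)
    ultimately show ?thesis by simp
  qed
  ultimately show ?case
    using b' z by (intro exI[of _ b'']) (auto simp: b''_def)
qed

text \<open>Once the nonzero frequencies of a large finite set are cancelled, evaluation at \<xi> =
  0 expresses \<open>b 0\<close> as minus the sum of the remaining coefficients, which is bounded by
  an arbitrarily small tail.\<close>

lemma trig_series_zero_coeff_0:
  fixes b :: "'a::real_inner \<Rightarrow> complex"
  assumes sm: "(\<lambda>\<mu>. norm (b \<mu>)) summable_on UNIV"
    and z: "\<And>\<xi>. ((\<lambda>\<mu>. b \<mu> * cis (\<mu> \<bullet> \<xi>)) has_sum 0) UNIV"
  shows "b 0 = 0"
proof -
  have "norm (b 0) \<le> e" if e: "e > 0" for e
  proof -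
    obtain F where F: "finite F" "(\<Sum>\<^sub>\<infinity>m\<in>-F. norm (b m)) < e"
      using abs_summable_small_tail[OF sm e] .
    obtain b' where b': "b' 0 = b 0" "\<And>\<mu>. norm (b' \<mu>) \<le> norm (b \<mu>)" "\<And>\<mu>. \<mu>\<in>F-{0} \<Longrightarrow> b' \<mu> = 0"
      "\<And>\<xi>. ((\<lambda>\<mu>. b' \<mu> * cis (\<mu> \<bullet> \<xi>)) has_sum 0) UNIV"
      using trig_series_cancel_finite[of "F - {0}" b] F(1) z by auto
    have sm': "(\<lambda>\<mu>. norm (b' \<mu>)) summable_on A" for A
      by (rule Infinite_Sum.abs_summable_on_comparison_test'[OF summable_on_subset_banach[OF sm]]) (use b' in auto)
    have hs: "(b' has_sum 0) UNIV" using b'(4)[of 0] by simp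
    have "(b' has_sum (0 - b' 0)) (UNIV - {0})"
      by (rule has_sum_Diff[OF hs]) (auto simp: has_sum_finiteI)
    then have "norm (b 0) = norm (infsum b' (UNIV - {0}))"
      using b'(1) by (simp add: infsumI)
    also have "\<dots> \<le> (\<Sum>\<^sub>\<infinity>\<mu>\<in>UNIV-{0}. norm (b' \<mu>))"
      by (rule norm_infsum_bound[OF sm'])
    \<comment> \<open>\<open>b'\<close> vanishes on \<open>F - {0}\<close>, so every nonzero term of
      the left sum has its index outside \<open>F\<close>.\<close>
    also have "\<dots> \<le> (\<Sum>\<^sub>\<infinity>\<mu>\<in>-F. norm (b \<mu>))"
      by (rule infsum_mono_neutral) (use b' sm' summable_on_subset_banach[OF sm] in auto)
    finally show ?thesis using F by simp
  qed
  then show ?thesis using field_le_epsilon[of "norm (b 0)" 0] by simp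
qed

text \<open>Multiplying by the character \<open>cis (- (\<nu> \<bullet> \<xi>))\<close> moves
  frequency \<nu> to 0. Writing \<nu> as \<open>0 - (-\<nu>)\<close> presents the moved coefficients
  as a translate.\<close>

lemma trig_series_zero:
  fixes b :: "'a::real_inner \<Rightarrow> complex"
  assumes sm: "(\<lambda>\<mu>. norm (b \<mu>)) summable_on UNIV"
    and z: "\<And>\<xi>. ((\<lambda>\<mu>. b \<mu> * cis (\<mu> \<bullet> \<xi>)) has_sum 0) UNIV"
  shows "b \<nu> = 0"
proof -
  have "b (0 - (-\<nu>)) = 0"
  proof (rule trig_series_zero_coeff_0)
    show "(\<lambda>\<mu>. norm (b (\<mu> - (-\<nu>)))) summable_on UNIV"
      using sm has_sum_translate_iff[of "\<lambda>\<mu>. norm (b \<mu>)" "-\<nu>"] by (auto simp: summable_on_def)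
    fix \<xi>
    have "((\<lambda>\<mu>. cis (- (\<nu> \<bullet> \<xi>)) * (b (\<mu> - (-\<nu>)) * cis ((\<mu> - (-\<nu>)) \<bullet> \<xi>))) has_sum (cis (- (\<nu> \<bullet> \<xi>)) * 0)) UNIV"
      using z[of \<xi>] by (intro has_sum_cmult_right) (subst has_sum_translate_iff)
    moreover have "cis (- (\<nu> \<bullet> \<xi>)) * (b (\<mu> - (-\<nu>)) * cis ((\<mu> - (-\<nu>)) \<bullet> \<xi>)) = b (\<mu> - (-\<nu>)) * cis (\<mu> \<bullet> \<xi>)" for \<mu>
      by (simp add: inner_add_left cis_mult mult.left_commute)
    ultimately show "((\<lambda>\<mu>. b (\<mu> - (-\<nu>)) * cis (\<mu> \<bullet> \<xi>)) has_sum 0) UNIV"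
      by (simp only: mult_zero_right)
  qed
  then show ?thesis by simp
qed

section \<open>Time-frequency shifts and their series on bounded functions\<close>

text \<open>The phase arises because the translation by \<open>fst l\<close> also shifts the
  argument of the modulation by \<open>snd m\<close>. It is the source of the phases in both twisted
  convolutions.\<close>

lemma tf_shift_tf_shift:
  "tf_shift l (tf_shift m f) x = cis (- (snd m \<bullet> fst l)) * tf_shift (l + m) f x"
  by (simp add: tf_shift_def inner_add_left inner_diff_right cis_mult algebra_simps)

lemma tf_shift_zero [simp]: "tf_shift 0 f x = f x"
  by (simp add: tf_shift_def)

lemma summable_tf_shift:
  fixes a :: "'n::finite tf_index \<Rightarrow> complex"
  assumes "(\<lambda>m. norm (a m)) summable_on UNIV" "\<And>x. norm (f x) \<le> B"
  shows "(\<lambda>m. a m * tf_shift m f x) summable_on UNIV"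
proof -
  have "(\<lambda>m. norm (a m * tf_shift m f x)) summable_on UNIV"
    by (rule Infinite_Sum.abs_summable_on_comparison_test'[OF summable_on_cmult_left[OF assms(1), of B]])
      (auto simp: norm_mult tf_shift_def intro!: mult_left_mono assms)
  then show ?thesis by (rule abs_summable_summable)
qed

text \<open>Weierstrass M-test with majorant \<open>norm (a m) * B\<close>. Continuity serves to
  upgrade almost everywhere identities to pointwise ones.\<close>

lemma continuous_tf_series_op:
  fixes a :: "'n::finite tf_index \<Rightarrow> complex"
  assumes "(\<lambda>m. norm (a m)) summable_on UNIV" "\<And>x. norm (f x) \<le> B" "continuous_on UNIV f"
  shows "continuous_on UNIV (tf_series_op a f)"
  unfolding tf_series_op_def
proof (rule uniform_limit_theorem)
  show "uniform_limit UNIV (\<lambda>X y. \<Sum>l\<in>X. a l * tf_shift l f y)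
     (\<lambda>x. \<Sum>\<^sub>\<infinity>l. a l * tf_shift l f x) (finite_subsets_at_top UNIV)"
    by (rule Weierstrass_m_test_general[OF _ summable_on_cmult_left[OF assms(1), of B]])
      (auto simp: norm_mult tf_shift_def intro!: mult_left_mono assms)
  have "continuous_on UNIV (\<lambda>x. f (x - t))" for t
    by (rule continuous_on_compose2[OF assms(3)]) (auto intro!: continuous_intros)
  then show "\<forall>\<^sub>F X in finite_subsets_at_top UNIV. continuous_on UNIV (\<lambda>y. \<Sum>l\<in>X. a l * tf_shift l f y)"
    unfolding tf_shift_def cis_conv_exp
    by (intro always_eventually allI continuous_intros) auto
qed auto

section \<open>Tent waves determine the coefficients of the operator\<close>

text \<open>Test functions that are continuous, bounded and compactly supported: they lie in
  \<open>L2\<close>, and the operator series converges absolutely at every point. Frequency and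
  centre stay free so that both can vary with the evaluation point.\<close>

definition tent_wave :: "real^'n \<Rightarrow> real^'n \<Rightarrow> real^'n \<Rightarrow> complex" where
  "tent_wave \<xi> s x = cis (\<xi> \<bullet> x) * of_real (max 0 (1 - norm (x - s)))"

lemma norm_tent_wave_le: "norm (tent_wave \<xi> s x) \<le> 1"
  by (simp add: tent_wave_def norm_mult)

lemma continuous_tent_wave: "continuous_on A (tent_wave \<xi> s)"
  unfolding tent_wave_def cis_conv_exp by (intro continuous_intros)

lemma tent_wave_L2: "tent_wave \<xi> s \<in> L2"
proof -
  have m: "tent_wave \<xi> s \<in> borel_measurable borel"
    by (rule borel_measurable_continuous_onI[OF continuous_tent_wave])
  have "integrable lebesgue (\<lambda>x. (cmod (tent_wave \<xi> s x))\<^sup>2)"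
  proof (rule Bochner_Integration.integrable_bound)
    show "integrable lebesgue (indicat_real (cball s 1))"
      by (rule integrable_real_indicator) (use emeasure_lborel_cball_finite[of s 1] in \<open>auto simp: less_top\<close>)
    show "(\<lambda>x. (cmod (tent_wave \<xi> s x))\<^sup>2) \<in> borel_measurable lebesgue"
      using m by (intro measurable_completion) measurable
    show "AE x in lebesgue. norm ((cmod (tent_wave \<xi> s x))\<^sup>2) \<le> norm (indicat_real (cball s 1) x)"
      by (intro AE_I2)
        (auto simp: indicator_def tent_wave_def norm_mult dist_norm norm_minus_commute abs_square_le_1)
  qed
  then show ?thesis using m by (auto simp: L2_def intro: measurable_completion)
qed

text \<open>The difference from the identity annihilates all tent waves. Letting their frequency and
  centre depend on a phase-space point \<eta> makes this a vanishing trigonometric series in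
  \<eta>.\<close>

lemma tf_series_op_identity_coeffs:
  fixes a :: "'n::finite tf_index \<Rightarrow> complex"
  assumes sm: "(\<lambda>m. norm (a m)) summable_on UNIV"
    and id: "\<And>\<xi> s. AE x in lebesgue. tf_series_op a (tent_wave \<xi> s) x = tent_wave \<xi> s x"
  shows "a m = of_bool (m = 0)"
proof -
  define b where "b = (\<lambda>m. a m - of_bool (m = 0))"
  have smb: "(\<lambda>m. norm (b m)) summable_on UNIV"
  proof (rule Infinite_Sum.abs_summable_on_comparison_test')
    have "(\<lambda>m::'n tf_index. of_bool (m = 0) :: real) summable_on UNIV"
      by (rule summable_on_cong_neutral[THEN iffD1, OF _ _ _ summable_on_finite[of "{0}"]]) auto
    then show "(\<lambda>m. norm (a m) + of_bool (m = 0)) summable_on UNIV"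
      by (rule summable_on_add[OF sm])
    show "norm (b m) \<le> norm (a m) + of_bool (m = 0)" for m
      using norm_triangle_ineq4[of "a m" "of_bool (m = 0)"] by (auto simp: b_def)
  qed
  have eq: "tf_series_op a (tent_wave \<xi> s) x = tent_wave \<xi> s x" for \<xi> s x
  proof -
    \<comment> \<open>A closed set of full Lebesgue measure is the whole space.\<close>
    have "closed {x. tf_series_op a (tent_wave \<xi> s) x = tent_wave \<xi> s x}"
      by (intro closed_Collect_eq continuous_tent_wave
          continuous_tf_series_op[OF sm norm_tent_wave_le])
    from mem_closed_if_AE_lebesgue[OF this] id show ?thesis by simp
  qed
  have hs: "((\<lambda>m. b m * tf_shift m (tent_wave \<xi> s) x) has_sum 0) UNIV" for \<xi> s x
  proof -
    have 1: "((\<lambda>m. a m * tf_shift m (tent_wave \<xi> s) x) has_sum tent_wave \<xi> s x) UNIV"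
      using summable_tf_shift[OF sm norm_tent_wave_le] eq[of \<xi> s x]
      by (simp add: has_sum_iff tf_series_op_def)
    have 2: "((\<lambda>m. of_bool (m = 0) * tf_shift m (tent_wave \<xi> s) x) has_sum tent_wave \<xi> s x) UNIV"
      by (rule has_sum_cong_neutral[THEN iffD1, OF _ _ _ has_sum_finiteI[of "{0}"]]) auto
    show ?thesis
      using has_sum_add[OF 1 has_sum_uminusI[OF 2]]
      by (simp add: b_def left_diff_distrib)
  qed
  define t where "t = fst m"
  \<comment> \<open>The tent factor is 1 at \<open>k = m\<close>, so
    \<open>g m = b m\<close>.\<close>
  define g where "g = (\<lambda>k. b k * of_real (max 0 (1 - norm (t - fst k))))"
  have "g m = 0"
  proof (rule trig_series_zero[of g])
    show "(\<lambda>m. norm (g m)) summable_on UNIV"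
      by (rule Infinite_Sum.abs_summable_on_comparison_test'[OF smb]) (auto simp: g_def norm_mult intro!: mult_left_le)
    fix \<eta> :: "'n tf_index"
    define p x where "p = fst \<eta>" and "x = snd \<eta>"
    \<comment> \<open>The centre \<open>x - t\<close> moves with \<open>x\<close>, so the tent value
      depends on \<open>fst m\<close> only. The frequency \<open>-p\<close>, together with the
      factor \<open>cis (p \<bullet> x)\<close>, leaves exactly the character
      \<open>cis (m \<bullet> \<eta>)\<close>.\<close>
    have "((\<lambda>m. cis (p \<bullet> x) * (b m * tf_shift m (tent_wave (-p) (x - t)) x)) has_sum (cis (p \<bullet> x) * 0)) UNIV"
      by (rule has_sum_cmult_right[OF hs])
    moreover have "cis (p \<bullet> x) * (b m * tf_shift m (tent_wave (-p) (x - t)) x) = g m * cis (m \<bullet> \<eta>)" for m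
    proof -
      have 1: "x - fst m - (x - t) = t - fst m" by simp
      have 2: "cis (p \<bullet> x) * (cis (snd m \<bullet> x) * cis ((-p) \<bullet> (x - fst m))) = cis (m \<bullet> \<eta>)"
        by (simp add: cis_mult inner_prod_def p_def x_def inner_diff_right inner_commute[of "fst \<eta>" "fst m"] add.commute)
      show ?thesis
        by (simp only: tf_shift_def tent_wave_def g_def 1 2[symmetric] mult_ac)
    qed
    ultimately show "((\<lambda>m. g m * cis (m \<bullet> \<eta>)) has_sum 0) UNIV" by simp
  qed
  then show ?thesis by (auto simp: g_def t_def b_def)
qed

section \<open>Composition of operators as twisted convolution\<close>

text \<open>\<open>c * d\<close> with the phase of \<open>tf_shift_tf_shift\<close>; the right
  version is \<open>d * c\<close>. In both the sum runs over the finite support \<Lambda> of the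
  factor \<open>c\<close>.\<close>

definition twisted_conv_left ::
  "'n::finite tf_index set \<Rightarrow> ('n tf_index \<Rightarrow> complex) \<Rightarrow> ('n tf_index \<Rightarrow> complex) \<Rightarrow> 'n tf_index \<Rightarrow> complex" where
  "twisted_conv_left \<Lambda> c d m = (\<Sum>l\<in>\<Lambda>. c l * d (m - l) * cis (- (snd (m - l) \<bullet> fst l)))"

definition twisted_conv_right ::
  "'n::finite tf_index set \<Rightarrow> ('n tf_index \<Rightarrow> complex) \<Rightarrow> ('n tf_index \<Rightarrow> complex) \<Rightarrow> 'n tf_index \<Rightarrow> complex" where
  "twisted_conv_right \<Lambda> c d m = (\<Sum>l\<in>\<Lambda>. d (m - l) * c l * cis (- (snd l \<bullet> fst (m - l))))"

text \<open>The abstract term \<open>u\<close> hides the unimodular phase, so that both twisted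
  convolutions are covered.\<close>

lemma summable_finite_conv:
  fixes d :: "'a::ab_group_add \<Rightarrow> complex"
  assumes "finite \<Lambda>" "(\<lambda>m. norm (d m)) summable_on UNIV"
    and "\<And>m l. norm (u m l) \<le> norm (c l) * norm (d (m - l))"
  shows "(\<lambda>m. norm (\<Sum>l\<in>\<Lambda>. u m l)) summable_on UNIV"
proof (rule Infinite_Sum.abs_summable_on_comparison_test')
  obtain s where s: "((\<lambda>m. norm (d m)) has_sum s) UNIV" using assms(2) by (auto simp: summable_on_def)
  have "((\<lambda>m. \<Sum>l\<in>\<Lambda>. norm (c l) * norm (d (m - l))) has_sum (\<Sum>l\<in>\<Lambda>. norm (c l) * s)) UNIV"
    by (intro has_sum_sum_finite has_sum_cmult_right has_sum_translate_iff[THEN iffD2, OF s] assms)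
  then show "(\<lambda>m. \<Sum>l\<in>\<Lambda>. norm (c l) * norm (d (m - l))) summable_on UNIV"
    by (rule has_sum_imp_summable)
qed (auto intro!: sum_norm_le assms)

lemma summable_twisted_conv_left:
  assumes "finite \<Lambda>" "(\<lambda>m. norm (d m)) summable_on UNIV"
  shows "(\<lambda>m. norm (twisted_conv_left \<Lambda> c d m)) summable_on UNIV"
  unfolding twisted_conv_left_def
  by (rule summable_finite_conv[OF assms, of _ c]) (auto simp: norm_mult)

lemma summable_twisted_conv_right:
  assumes "finite \<Lambda>" "(\<lambda>m. norm (d m)) summable_on UNIV"
  shows "(\<lambda>m. norm (twisted_conv_right \<Lambda> c d m)) summable_on UNIV"
  unfolding twisted_conv_right_def
  by (rule summable_finite_conv[OF assms, of _ c]) (auto simp: norm_mult)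

text \<open>A finite combination of convergent series may be summed termwise; reindexing the series
  for \<open>l\<close> by \<open>m - l\<close> collects the coefficient of each
  \<open>tf_shift m\<close>.\<close>

lemma tf_finite_op_tf_series_op:
  assumes "finite \<Lambda>" "(\<lambda>m. norm (d m)) summable_on UNIV" "\<And>x. norm (f x) \<le> B"
  shows "tf_finite_op \<Lambda> c (tf_series_op d f) x = tf_series_op (twisted_conv_left \<Lambda> c d) f x"
proof -
  have S: "((\<lambda>m. d m * tf_shift m f y) has_sum tf_series_op d f y) UNIV" for y
    using summable_tf_shift[OF assms(2,3)] by (simp add: tf_series_op_def)
  have "((\<lambda>m. \<Sum>l\<in>\<Lambda>. c l * (cis (snd l \<bullet> x) * (d (m - l) * tf_shift (m - l) f (x - fst l))))
      has_sum tf_finite_op \<Lambda> c (tf_series_op d f) x) UNIV"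
    unfolding tf_finite_op_def tf_shift_def[of _ "tf_series_op d f"] using S
    by (intro has_sum_sum_finite has_sum_cmult_right assms)
      (subst has_sum_translate_iff[where g="\<lambda>m. d m * tf_shift m f y" for y])
  moreover have "c l * (cis (snd l \<bullet> x) * (d (m - l) * tf_shift (m - l) f (x - fst l)))
      = c l * d (m - l) * cis (- (snd (m - l) \<bullet> fst l)) * tf_shift m f x" for l m
    using tf_shift_tf_shift[of l "m - l" f x] by (simp add: tf_shift_def[of l] algebra_simps)
  ultimately show ?thesis
    by (simp add: tf_series_op_def twisted_conv_left_def sum_distrib_right infsumI)
qed

lemma tf_series_op_tf_finite_op:
  assumes "finite \<Lambda>" "(\<lambda>m. norm (d m)) summable_on UNIV" "\<And>x. norm (f x) \<le> B"
  shows "tf_series_op d (tf_finite_op \<Lambda> c f) x = tf_series_op (twisted_conv_right \<Lambda> c d) f x"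
proof -
  \<comment> \<open>The value of the series on the shifted function; both sides of the claim equal
    \<open>\<Sum>l\<in>\<Lambda>. c l * S l\<close>, one directly and one after translating the
    index by \<open>l\<close>.\<close>
  define S where "S = (\<lambda>l. \<Sum>\<^sub>\<infinity>m. d m * tf_shift m (tf_shift l f) x)"
  have S: "((\<lambda>m. d m * tf_shift m (tf_shift l f) x) has_sum S l) UNIV" for l
    unfolding S_def using assms(3)
    by (intro has_sum_infsum summable_tf_shift[OF assms(2), of _ B]) (auto simp: tf_shift_def norm_mult)
  have "((\<lambda>m. \<Sum>l\<in>\<Lambda>. c l * (d m * tf_shift m (tf_shift l f) x)) has_sum (\<Sum>l\<in>\<Lambda>. c l * S l)) UNIV"
    by (intro has_sum_sum_finite has_sum_cmult_right S assms)
  moreover have "(\<Sum>l\<in>\<Lambda>. c l * (d m * tf_shift m (tf_shift l f) x)) = d m * tf_shift m (tf_finite_op \<Lambda> c f) x" for m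
    by (simp add: tf_shift_def[of m] tf_finite_op_def sum_distrib_left mult_ac)
  ultimately have 1: "tf_series_op d (tf_finite_op \<Lambda> c f) x = (\<Sum>l\<in>\<Lambda>. c l * S l)"
    by (simp add: tf_series_op_def infsumI)
  have "((\<lambda>m. \<Sum>l\<in>\<Lambda>. c l * (d (m - l) * tf_shift (m - l) (tf_shift l f) x)) has_sum (\<Sum>l\<in>\<Lambda>. c l * S l)) UNIV"
    using S by (intro has_sum_sum_finite has_sum_cmult_right assms)
      (subst has_sum_translate_iff[where g="\<lambda>m. d m * tf_shift m (tf_shift l f) x" for l])
  then have "tf_series_op (twisted_conv_right \<Lambda> c d) f x = (\<Sum>l\<in>\<Lambda>. c l * S l)"
    unfolding tf_series_op_def twisted_conv_right_def
    by (intro infsumI) (simp add: tf_shift_tf_shift sum_distrib_right sum_distrib_left mult_ac)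
  with 1 show ?thesis by simp
qed

section \<open>Exponential weights\<close>

text \<open>The weight is truncated at \<open>M\<close>, which keeps it submultiplicative, so that the weighted norm
  of \<open>d\<close> is known to be finite and can be absorbed; the resulting bound does not depend on \<open>M\<close>.\<close>

lemma exp_weight_summable_of_conv_le:
  fixes h g \<rho> :: "'a::euclidean_space \<Rightarrow> real"
  assumes sm: "h summable_on UNIV" and h: "\<And>m. h m \<ge> 0" and \<rho>: "\<And>q. \<rho> q \<ge> 0"
    and Q: "finite Q" and F: "finite F"
    and le: "\<And>m. h m \<le> g m + (\<Sum>q\<in>Q. h (m - q) * \<rho> q)"
    and g0: "\<And>m. m \<notin> F \<Longrightarrow> g m = 0" "\<And>m. g m \<ge> 0"
    and small: "(\<Sum>q\<in>Q. \<rho> q) < 1"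
  shows "\<exists>\<delta>>0. (\<lambda>m. exp (\<delta> * infnorm m) * h m) summable_on UNIV"
proof -
  \<comment> \<open>A finite sum is continuous in \<delta>, so the strict bound at \<delta> = 0
    persists for small positive \<delta>.\<close>
  have "((\<lambda>\<delta>. \<Sum>q\<in>Q. exp (\<delta> * infnorm q) * \<rho> q) \<longlongrightarrow> (\<Sum>q\<in>Q. exp (0 * infnorm q) * \<rho> q)) (at_right 0)"
    by (intro tendsto_intros)
  then have "\<forall>\<^sub>F \<delta> in at_right 0. (\<Sum>q\<in>Q. exp (\<delta> * infnorm q) * \<rho> q) < 1"
    using small by (auto intro: order_tendstoD)
  moreover have "\<forall>\<^sub>F \<delta> in at_right 0. \<delta> > (0::real)"
    by (simp add: eventually_at_right_less)
  ultimately have "\<forall>\<^sub>F \<delta> in at_right 0. (\<Sum>q\<in>Q. exp (\<delta> * infnorm q) * \<rho> q) < 1 \<and> \<delta> > 0"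
    by (rule eventually_conj)
  then obtain \<delta> where \<delta>: "(\<Sum>q\<in>Q. exp (\<delta> * infnorm q) * \<rho> q) < 1" "\<delta> > 0"
    using eventually_happens'[of "at_right (0::real)"] by auto
  define R where "R = (\<Sum>q\<in>Q. exp (\<delta> * infnorm q) * \<rho> q)"
  define w where "w = (\<lambda>q::'a. exp (\<delta> * infnorm q))"
  have w1: "w q \<ge> 1" for q using \<delta> by (simp add: w_def infnorm_pos_le)
  have wmult: "w (p + q) \<le> w p * w q" for p q
    using \<delta> infnorm_triangle[of p q] by (simp add: w_def flip: exp_add distrib_left)
  define C where "C = (\<Sum>m\<in>F. w m * g m)"
  have bound: "(\<Sum>\<^sub>\<infinity>m. min (w m) M * h m) \<le> C / (1 - R)" and
    smM: "(\<lambda>m. min (w m) M * h m) summable_on UNIV" if M: "M \<ge> 1" for M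
  proof -
    let ?v = "\<lambda>m. min (w m) M"
    have v0: "?v m \<ge> 0" for m using w1[of m] M by simp
    show sM: "(\<lambda>m. ?v m * h m) summable_on UNIV"
      by (rule summable_on_comparison_test[OF summable_on_cmult_right[OF sm, of M]])
        (use h v0 in \<open>auto intro!: mult_right_mono\<close>)
    define S where "S = (\<Sum>\<^sub>\<infinity>m. ?v m * h m)"
    have hs: "((\<lambda>m. ?v m * h m) has_sum S) UNIV" using sM by (simp add: S_def)
    \<comment> \<open>Below the truncation this is submultiplicativity of \<open>w\<close>;
      otherwise the right side is \<open>M * w q\<close>, at least \<open>M\<close> because
      \<open>w q \<ge> 1\<close>.\<close>
    have v: "?v m \<le> ?v (m - q) * w q" for m q
    proof (cases "w (m - q) \<le> M")
      case True
      then show ?thesis using wmult[of "m - q" q] by simp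
    next
      case False
      then show ?thesis using w1[of q] M mult_left_mono[of 1 "w q" M] by (simp add: min.coboundedI2)
    qed
    have p: "?v m * h m \<le> w m * g m + (\<Sum>q\<in>Q. (w q * \<rho> q) * (?v (m - q) * h (m - q)))" for m
    proof -
      have "?v m * h m \<le> ?v m * g m + (\<Sum>q\<in>Q. ?v m * (h (m - q) * \<rho> q))"
        using mult_left_mono[OF le[of m] v0[of m]] by (simp add: distrib_left sum_distrib_left)
      also have "\<dots> \<le> w m * g m + (\<Sum>q\<in>Q. (?v (m - q) * w q) * (h (m - q) * \<rho> q))"
        by (intro add_mono sum_mono mult_right_mono v mult_nonneg_nonneg h \<rho> g0) auto
      finally show ?thesis by (simp add: mult_ac)
    qed
    have "((\<lambda>m. w m * g m) has_sum C) UNIV"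
      unfolding C_def
      by (rule has_sum_cong_neutral[THEN iffD1, OF _ _ _ has_sum_finite[OF F]]) (auto simp: g0)
    moreover have "((\<lambda>m. \<Sum>q\<in>Q. (w q * \<rho> q) * (?v (m - q) * h (m - q))) has_sum (\<Sum>q\<in>Q. (w q * \<rho> q) * S)) UNIV"
      using hs by (intro has_sum_sum_finite has_sum_cmult_right Q)
        (subst has_sum_translate_iff[where g="\<lambda>m. ?v m * h m"])
    ultimately have "((\<lambda>m. w m * g m + (\<Sum>q\<in>Q. (w q * \<rho> q) * (?v (m - q) * h (m - q))))
      has_sum (C + (\<Sum>q\<in>Q. (w q * \<rho> q) * S))) UNIV"
      by (rule has_sum_add)
    \<comment> \<open>\<open>S\<close> is a finite number thanks to the truncation, so
      \<open>R * S\<close> with \<open>R < 1\<close> can be moved to the left.\<close>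
    from has_sum_mono[OF hs this] p have "S \<le> C + (\<Sum>q\<in>Q. (w q * \<rho> q) * S)" by simp
    also have "\<dots> = C + R * S" by (simp add: R_def w_def sum_distrib_right)
    finally show "(\<Sum>\<^sub>\<infinity>m. ?v m * h m) \<le> C / (1 - R)"
      using \<delta>(1) unfolding S_def[symmetric] R_def[symmetric] by (simp add: field_simps)
  qed
  have "(\<lambda>m. w m * h m) summable_on UNIV"
  proof (rule nonneg_bdd_above_summable_on)
    show "w m * h m \<ge> 0" for m using h by (simp add: w_def)
    show "bdd_above (sum (\<lambda>m. w m * h m) ` {F. F \<subseteq> UNIV \<and> finite F})"
    proof (rule bdd_aboveI2)
      fix G assume "G \<in> {F. F \<subseteq> (UNIV :: 'a set) \<and> finite F}"
      then have G: "finite G" by simp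
      \<comment> \<open>With this \<open>M\<close> the truncation is inactive on \<open>G\<close>;
        inserting 1 ensures \<open>M \<ge> 1\<close>.\<close>
      define M where "M = Max (insert 1 (w ` G))"
      have M: "M \<ge> 1" "\<And>m. m \<in> G \<Longrightarrow> w m \<le> M" using G by (auto simp: M_def)
      have "(\<Sum>m\<in>G. w m * h m) = (\<Sum>m\<in>G. min (w m) M * h m)"
        using M by (intro sum.cong) auto
      also have "\<dots> \<le> (\<Sum>\<^sub>\<infinity>m. min (w m) M * h m)"
        by (rule finite_sum_le_infsum[OF smM[OF M(1)] G]) (use h M in \<open>auto simp: w_def\<close>)
      also have "\<dots> \<le> C / (1 - R)" by (rule bound[OF M(1)])
      finally show "(\<Sum>m\<in>G. w m * h m) \<le> C / (1 - R)" .
    qed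
  qed
  then show ?thesis using \<delta>(2) unfolding w_def by blast
qed

section \<open>Decay of the twisted inverse\<close>

text \<open>This is the identity \<open>d = d' + d * (1 - c * d')\<close> for the restriction \<open>d'\<close> of \<open>d\<close> to \<open>F\<close>.\<close>

lemma twisted_inverse_decomposition:
  fixes c d :: "'n::finite tf_index \<Rightarrow> complex"
  assumes \<Lambda>: "finite \<Lambda>" and F: "finite F"
    and Q: "finite Q" "0 \<in> Q" "\<And>l p. l \<in> \<Lambda> \<Longrightarrow> p \<in> F \<Longrightarrow> p + l \<in> Q"
    and right: "\<And>m. twisted_conv_right \<Lambda> c d m = of_bool (m = 0)"
  defines "d' \<equiv> (\<lambda>m. if m \<in> F then d m else 0)"
  shows "d m = d' m + (\<Sum>q\<in>Q. d (m - q) * (of_bool (q = 0) - twisted_conv_left \<Lambda> c d' q) * cis (- (snd q \<bullet> fst (m - q))))"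
proof -
  let ?e = "\<lambda>q. cis (- (snd q \<bullet> fst (m - q)))"
  let ?T = "\<lambda>l q. d (m - q) * (c l * d' (q - l) * cis (- (snd (q - l) \<bullet> fst l))) * ?e q"
  \<comment> \<open>\<open>d'\<close> is supported in \<open>F\<close>, so only
    \<open>q = p + l\<close> with \<open>p \<in> F\<close> contributes.\<close>
  have inner: "(\<Sum>q\<in>Q. ?T l q) = (\<Sum>p\<in>F. ?T l (p + l))" if l: "l \<in> \<Lambda>" for l
  proof -
    have "(\<Sum>q\<in>(\<lambda>p. p + l) ` F. ?T l q) = (\<Sum>q\<in>Q. ?T l q)"
    proof (rule sum.mono_neutral_left)
      show "\<forall>q\<in>Q - (\<lambda>p. p + l) ` F. ?T l q = 0"
      proof
        fix q assume "q \<in> Q - (\<lambda>p. p + l) ` F"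
        then have "q - l \<notin> F" by (metis DiffD2 diff_add_cancel imageI)
        then show "?T l q = 0" by (simp add: d'_def)
      qed
    qed (use Q(1) Q(3)[OF l] in \<open>auto simp del: split_paired_All\<close>)
    then show ?thesis by (simp add: sum.reindex inj_on_def)
  qed
  have "(\<Sum>q\<in>Q. d (m - q) * twisted_conv_left \<Lambda> c d' q * ?e q) = (\<Sum>q\<in>Q. \<Sum>l\<in>\<Lambda>. ?T l q)"
    by (simp add: twisted_conv_left_def sum_distrib_left sum_distrib_right)
  also have "\<dots> = (\<Sum>l\<in>\<Lambda>. \<Sum>p\<in>F. ?T l (p + l))"
    by (subst sum.swap) (intro sum.cong inner refl)
  also have "\<dots> = (\<Sum>p\<in>F. \<Sum>l\<in>\<Lambda>. ?T l (p + l))" by (rule sum.swap)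
  also have "\<dots> = (\<Sum>p\<in>F. d p * cis (- (snd p \<bullet> fst (m - p))) * twisted_conv_right \<Lambda> c d (m - p))"
  proof (intro sum.cong refl)
    fix p assume p: "p \<in> F"
    \<comment> \<open>Associativity: the cocycle identity of the phases regroups
      \<open>d * (c * d')\<close> as \<open>(d * c) * d'\<close>.\<close>
    have "?T l (p + l) = d p * cis (- (snd p \<bullet> fst (m - p))) *
        (d (m - p - l) * c l * cis (- (snd l \<bullet> fst (m - p - l))))" for l
      using p by (simp add: d'_def cis_mult inner_add_left inner_diff_right algebra_simps)
    then show "(\<Sum>l\<in>\<Lambda>. ?T l (p + l)) = d p * cis (- (snd p \<bullet> fst (m - p))) * twisted_conv_right \<Lambda> c d (m - p)"
      by (simp only: twisted_conv_right_def sum_distrib_left)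
  qed
  also have "\<dots> = (\<Sum>p\<in>F. if p = m then d m else 0)"
    by (intro sum.cong refl) (auto simp: right)
  also have "\<dots> = d' m" using F by (simp add: d'_def)
  finally have 1: "(\<Sum>q\<in>Q. d (m - q) * twisted_conv_left \<Lambda> c d' q * ?e q) = d' m" .
  have "(\<Sum>q\<in>Q. d (m - q) * of_bool (q = 0) * ?e q) = (\<Sum>q\<in>Q. if q = 0 then d m else 0)"
    by (intro sum.cong) auto
  also have "\<dots> = d m" using Q by simp
  finally have 2: "(\<Sum>q\<in>Q. d (m - q) * of_bool (q = 0) * ?e q) = d m" .
  show ?thesis
    using 1 2 by (simp add: right_diff_distrib left_diff_distrib sum_subtractf)
qed

text \<open>The two inverse identities play different roles: \<open>c * d = 1\<close> makes
  \<open>r\<close> small, and \<open>d * c = 1\<close> gives the decomposition of \<open>d\<close>.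
  Taking norms removes the phases and leaves an ordinary convolution inequality.\<close>

lemma twisted_inverse_exp_decay:
  fixes c d :: "'n::finite tf_index \<Rightarrow> complex"
  assumes \<Lambda>: "finite \<Lambda>" and sm: "(\<lambda>m. norm (d m)) summable_on UNIV"
    and left: "\<And>m. twisted_conv_left \<Lambda> c d m = of_bool (m = 0)"
    and right: "\<And>m. twisted_conv_right \<Lambda> c d m = of_bool (m = 0)"
  shows "\<exists>\<delta>>0. (\<lambda>m. exp (\<delta> * infnorm m) * norm (d m)) summable_on UNIV"
proof -
  define K where "K = (\<Sum>l\<in>\<Lambda>. norm (c l))"
  have K: "K \<ge> 0" by (simp add: K_def sum_nonneg)
  \<comment> \<open>Convolution with \<open>c\<close> enlarges the tail by at most the factor
    \<open>K\<close>, and \<open>K / (K + 1) < 1\<close>; the added 1 also covers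
    \<open>K = 0\<close>.\<close>
  obtain F where F: "finite F" and tail: "(\<Sum>\<^sub>\<infinity>m\<in>-F. norm (d m)) < 1 / (K + 1)"
    using abs_summable_small_tail[OF sm, of "1 / (K + 1)"] K by auto
  define d' where "d' = (\<lambda>m. if m \<in> F then d m else 0)"
  \<comment> \<open>\<open>Q\<close> contains the support of \<open>r\<close>: 0 comes from the
    identity, the sums \<open>p + l\<close> from \<open>c * d'\<close>.\<close>
  define Q where "Q = insert 0 ((\<lambda>(p, l). p + l) ` (F \<times> \<Lambda>))"
  have Q: "finite Q" "0 \<in> Q" "\<And>l p. l \<in> \<Lambda> \<Longrightarrow> p \<in> F \<Longrightarrow> p + l \<in> Q"
    using F \<Lambda> by (auto simp: Q_def)
  define r where "r = (\<lambda>q. of_bool (q = 0) - twisted_conv_left \<Lambda> c d' q)"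
  define u where "u = (\<lambda>m. norm (d m - d' m))"
  have r_le: "norm (r q) \<le> (\<Sum>l\<in>\<Lambda>. norm (c l) * u (q - l))" for q
  proof -
    \<comment> \<open>Replacing the identity by \<open>c * d\<close> gives
      \<open>r = c * (d - d')\<close>.\<close>
    have "r q = (\<Sum>l\<in>\<Lambda>. c l * (d (q - l) - d' (q - l)) * cis (- (snd (q - l) \<bullet> fst l)))"
      unfolding r_def left[of q, symmetric]
      by (simp add: twisted_conv_left_def left_diff_distrib right_diff_distrib sum_subtractf)
    then show ?thesis
      by (auto simp: norm_mult u_def intro!: sum_norm_le)
  qed
  have smu: "u summable_on UNIV"
    unfolding u_def by (rule Infinite_Sum.abs_summable_on_comparison_test'[OF sm]) (auto simp: d'_def)
  have u_tail: "(\<Sum>\<^sub>\<infinity>m. u m) = (\<Sum>\<^sub>\<infinity>m\<in>-F. norm (d m))"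
    by (rule infsum_cong_neutral) (auto simp: u_def d'_def)
  have u_fin: "(\<Sum>q\<in>Q. u (q - l)) \<le> (\<Sum>\<^sub>\<infinity>m\<in>-F. norm (d m))" for l
  proof -
    have "(\<Sum>q\<in>Q. u (q - l)) = (\<Sum>m\<in>(\<lambda>q. q - l) ` Q. u m)"
      by (simp add: sum.reindex inj_on_def)
    also have "\<dots> \<le> (\<Sum>\<^sub>\<infinity>m. u m)"
      by (rule finite_sum_le_infsum[OF smu]) (use Q in \<open>auto simp: u_def\<close>)
    finally show ?thesis by (simp add: u_tail)
  qed
  have "(\<Sum>q\<in>Q. norm (r q)) \<le> (\<Sum>q\<in>Q. \<Sum>l\<in>\<Lambda>. norm (c l) * u (q - l))"
    by (intro sum_mono r_le)
  also have "\<dots> = (\<Sum>l\<in>\<Lambda>. norm (c l) * (\<Sum>q\<in>Q. u (q - l)))"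
    by (subst sum.swap) (simp add: sum_distrib_left)
  also have "\<dots> \<le> (\<Sum>l\<in>\<Lambda>. norm (c l) * (1 / (K + 1)))"
    by (intro sum_mono mult_left_mono order.trans[OF u_fin less_imp_le[OF tail]]) auto
  also have "\<dots> = K / (K + 1)" by (simp add: K_def sum_divide_distrib)
  also have "\<dots> < 1" using K by simp
  finally have small: "(\<Sum>q\<in>Q. norm (r q)) < 1" .
  have le: "norm (d m) \<le> norm (d' m) + (\<Sum>q\<in>Q. norm (d (m - q)) * norm (r q))" for m
  proof -
    have "d m = d' m + (\<Sum>q\<in>Q. d (m - q) * r q * cis (- (snd q \<bullet> fst (m - q))))"
      using twisted_inverse_decomposition[OF \<Lambda> F Q right, of m] by (simp add: r_def d'_def)
    then have "norm (d m) \<le> norm (d' m) + norm (\<Sum>q\<in>Q. d (m - q) * r q * cis (- (snd q \<bullet> fst (m - q))))"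
      by (rule ord_eq_le_trans[OF arg_cong[of _ _ norm] norm_triangle_ineq])
    also have "\<dots> \<le> norm (d' m) + (\<Sum>q\<in>Q. norm (d (m - q)) * norm (r q))"
      by (intro add_left_mono sum_norm_le) (simp add: norm_mult)
    finally show ?thesis .
  qed
  show ?thesis
    by (rule exp_weight_summable_of_conv_le[OF sm _ _ Q(1) F le _ _ small]) (auto simp: d'_def)
qed

section \<open>From operator identities to coefficient identities\<close>

theorem theorem6:
  fixes \<Lambda> :: "('n::finite) tf_index set"
    and c :: "'n tf_index \<Rightarrow> complex"
    and d :: "'n tf_index \<Rightarrow> complex"
  assumes "finite \<Lambda>"
    and "(\<lambda>\<mu>. norm (d \<mu>)) summable_on UNIV"
    and "\<forall>f\<in>L2. AE x in lebesgue. tf_series_op d (tf_finite_op \<Lambda> c f) x = f x"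
    and "\<forall>f\<in>L2. AE x in lebesgue. tf_finite_op \<Lambda> c (tf_series_op d f) x = f x"
  shows "\<exists>\<delta>>0. (\<lambda>\<mu>. exp (\<delta> * infnorm \<mu>) * norm (d \<mu>)) summable_on UNIV"
proof (rule twisted_inverse_exp_decay[OF assms(1,2)])
  show "twisted_conv_left \<Lambda> c d m = of_bool (m = 0)" for m
  proof (intro tf_series_op_identity_coeffs summable_twisted_conv_left assms(1,2))
    \<comment> \<open>On tent waves, bounded by 1, the composition formula holds at every point, so
      the inverse identity becomes one for a single series.\<close>
    show "AE x in lebesgue. tf_series_op (twisted_conv_left \<Lambda> c d) (tent_wave \<xi> s) x = tent_wave \<xi> s x" for \<xi> s
      using assms(4)[rule_format, OF tent_wave_L2[of \<xi> s]]
      by (simp add: tf_finite_op_tf_series_op[OF assms(1,2), of _ 1] norm_tent_wave_le)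
  qed
  show "twisted_conv_right \<Lambda> c d m = of_bool (m = 0)" for m
  proof (intro tf_series_op_identity_coeffs summable_twisted_conv_right assms(1,2))
    show "AE x in lebesgue. tf_series_op (twisted_conv_right \<Lambda> c d) (tent_wave \<xi> s) x = tent_wave \<xi> s x" for \<xi> s
      using assms(3)[rule_format, OF tent_wave_L2[of \<xi> s]]
      by (simp add: tf_series_op_tf_finite_op[OF assms(1,2), of _ 1] norm_tent_wave_le)
  qed
qed

end
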